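(* Let $q$ be a prime power and $r,k,s$ integers with $0\le k\le r-1$ and $s\ge r-k$. Then $D_q(r,k,s)\le 1-\pi_{q,r,k}$.
   Context: For a matroid $M$ of rank $r$ and an integer $k\ge 0$, the $k$-dependence of $M$ is the proportion of the size-$(r-k)$ subsets of the ground set of $M$ that are dependent. For a matrix over $\mathbb{F}_q$, its subsets are subsets of its columns (as a multiset), and its $k$-dependence is that of its column matroid. $D_q(r,k,s)$ denotes the smallest $d$ such that there exists a full-rank $r\times s$ matrix over $\mathbb{F}_q$ with $k$-dependence $\le d$. $\pi_{q,r,k}$ denotes the probability that $r-k$ nonzero vectors chosen independently and uniformly at random from $\mathbb{F}_q^r\setminus\{0\}$ are linearly independent. *)

theory Defs
  imports
    "HOL-Number_Theory.Prime_Powers"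
    "HOL-Probability.Product_PMF"
    "Jordan_Normal_Form.DL_Rank"
begin

section \<open>Matroids\<close>

locale matroid =
  fixes E :: "'e set" and indep :: "'e set \<Rightarrow> bool"
  assumes finite_ground: "finite E"
    and indep_subset_ground: "indep X \<Longrightarrow> X \<subseteq> E"
    and indep_empty: "indep {}"
    and indep_mono: "indep X \<Longrightarrow> Y \<subseteq> X \<Longrightarrow> indep Y"
    and augmentation:
      "indep X \<Longrightarrow> indep Y \<Longrightarrow> card X < card Y \<Longrightarrow> \<exists>y\<in>Y - X. indep (insert y X)"
begin

definition rk :: nat where
  "rk = Max {card X | X. indep X}"

text \<open>The subtraction is truncated, so for \<open>k > rk\<close> the only set considered is the empty one,
  and the \<open>k\<close>-dependence is \<open>0\<close>.\<close>

definition k_dependence :: "nat \<Rightarrow> real" where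
  "k_dependence k =
     real (card {X. X \<subseteq> E \<and> card X = rk - k \<and> \<not> indep X}) /
     real (card {X. X \<subseteq> E \<and> card X = rk - k})"

end

section \<open>Column matroids\<close>

context vec_space
begin

text \<open>Linear independence of an indexed family. The library predicate concerns sets of vectors;
  injectivity makes a family with a repeated vector dependent.\<close>

definition indpt_family :: "('i \<Rightarrow> 'a vec) \<Rightarrow> 'i set \<Rightarrow> bool" where
  "indpt_family v I \<longleftrightarrow> inj_on v I \<and> lin_indpt (v ` I)"

lemma lin_indpt_card_le:
  assumes "finite A" "finite B" "B \<subseteq> carrier_vec n" "lin_indpt A" "A \<subseteq> span B"
  shows "card A \<le> card B"
  using replacement[OF assms(1,2) _ assms(4,5)] assms(3) by fastforce

lemma indpt_family_augment:
  assumes fin: "finite X" "finite Y"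
    and X: "indpt_family v X" and Y: "indpt_family v Y"
    and vX: "v ` X \<subseteq> carrier_vec n" and vY: "v ` Y \<subseteq> carrier_vec n"
    and less: "card X < card Y"
  shows "\<exists>y\<in>Y - X. indpt_family v (insert y X)"
proof (rule ccontr)
  assume neg: "\<not> ?thesis"
  have "v y \<in> span (v ` X)" if y: "y \<in> Y" for y
  proof (cases "v y \<in> v ` X")
    case True
    then show ?thesis using span_mem[of "v ` X"] vX by auto
  next
    case False
    then have "y \<notin> X" "inj_on v (insert y X)"
      using X by (auto simp: indpt_family_def)
    then have "lin_dep (v ` X \<union> {v y})"
      using neg y by (auto simp: indpt_family_def)
    then show ?thesis
      using lin_dep_iff_in_span[of "v ` X" "v y"] X vX vY y False
      by (auto simp: indpt_family_def)
  qed
  then have "card (v ` Y) \<le> card (v ` X)"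
    using fin vX Y by (intro lin_indpt_card_le) (auto simp: indpt_family_def)
  then show False
    using X Y less by (auto simp: indpt_family_def card_image)
qed

end

text \<open>The ground set consists of the column indices rather than the columns, so that equal columns
  are distinct elements.\<close>

definition col_indep :: "'a::field mat \<Rightarrow> nat set \<Rightarrow> bool" where
  "col_indep A X \<longleftrightarrow>
     X \<subseteq> {..<dim_col A} \<and> vec_space.indpt_family (dim_row A) (col A) X"

lemma matroid_col_indep: "matroid {..<dim_col A} (col_indep A)"
proof -
  interpret vec_space "TYPE('a)" "dim_row A" .
  show ?thesis
  proof
    show "col_indep A {}"
      by (auto simp: col_indep_def indpt_family_def lin_dep_def)
  next
    fix X Y assume "col_indep A X" "Y \<subseteq> X"
    then show "col_indep A Y"
      using subset_li_is_li[of "col A ` X" "col A ` Y"]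
      by (auto simp: col_indep_def indpt_family_def inj_on_subset image_mono)
  next
    fix X Y assume XY: "col_indep A X" "col_indep A Y" "card X < card Y"
    then have "finite X" "finite Y"
      by (auto simp: col_indep_def intro: finite_subset)
    then show "\<exists>y\<in>Y - X. col_indep A (insert y X)"
      using indpt_family_augment[of X Y "col A"] XY
      by (fastforce simp: col_indep_def)
  qed (auto simp: col_indep_def)
qed

definition mat_dependence :: "'a::field mat \<Rightarrow> nat \<Rightarrow> real" where
  "mat_dependence A k = matroid.k_dependence {..<dim_col A} (col_indep A) k"

definition full_rank :: "'a::field mat \<Rightarrow> bool" where
  "full_rank A \<longleftrightarrow> vec_space.rank (dim_row A) A = min (dim_row A) (dim_col A)"

section \<open>The quantities \<open>D\<close> and \<open>\<pi>\<close>\<close>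

text \<open>The type \<open>'a\<close> plays the role of the field with \<open>q\<close> elements.\<close>

definition D_min :: "'a::{field,finite} itself \<Rightarrow> nat \<Rightarrow> nat \<Rightarrow> nat \<Rightarrow> real" where
  "D_min TYPE('a) r k s =
     (LEAST d. \<exists>A :: 'a mat. A \<in> carrier_mat r s \<and> full_rank A \<and> mat_dependence A k \<le> d)"

text \<open>\<open>Pi_pmf\<close> is the law of \<open>r - k\<close> independent vectors indexed by \<open>{..<r - k}\<close>; outside that set
  the random family takes the irrelevant default value \<open>0\<close>.\<close>

definition indep_prob :: "'a::{field,finite} itself \<Rightarrow> nat \<Rightarrow> nat \<Rightarrow> real" where
  "indep_prob TYPE('a) r k =
     measure_pmf.prob
       (Pi_pmf {..<r - k} (0\<^sub>v r) (\<lambda>_. pmf_of_set (carrier_vec r - {0\<^sub>v r :: 'a vec})))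
       {v. vec_space.indpt_family r v {..<r - k}}"

end

theory Submission
  imports Defs
begin

text \<open>The columns of a random matrix with nonzero columns have expected \<open>k\<close>-dependence
  \<open>1 - \<pi>\<close>, so some such matrix has at most \<open>1 - \<pi>\<close> dependent \<open>(r - k)\<close>-sets. It need not have full
  rank, but a column that lies outside a maximal independent set of columns can be replaced by a
  vector outside the column space without destroying the independence of any set of columns.
  For \<open>s < r\<close> the same replacement yields a matrix with independent columns.\<close>

section \<open>Independent families of vectors and their enlargement\<close>

context vec_space
begin

lemma indpt_family_cong:
  assumes "\<And>i. i \<in> I \<Longrightarrow> v i = w i"
  shows "indpt_family v I \<longleftrightarrow> indpt_family w I"
proof -
  have "v ` I = w ` I" "inj_on v I = inj_on w I"
    using assms inj_on_cong[of I v w] by auto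
  then show ?thesis by (simp add: indpt_family_def)
qed

lemma indpt_family_comp:
  assumes "bij_betw h J I"
  shows "indpt_family (v \<circ> h) J \<longleftrightarrow> indpt_family v I"
  using assms comp_inj_on_iff[of h J v]
  by (auto simp: indpt_family_def bij_betw_def image_comp)

lemma indpt_family_empty: "indpt_family v {}"
  by (auto simp: indpt_family_def lin_dep_def)

lemma indpt_family_mono:
  assumes "indpt_family v I" "J \<subseteq> I"
  shows "indpt_family v J"
  using assms subset_li_is_li[of "v ` I" "v ` J"]
  by (auto simp: indpt_family_def inj_on_subset image_mono)

lemma indpt_family_insert:
  assumes "indpt_family v I" "v ` insert i I \<subseteq> carrier_vec n" "v i \<notin> span (v ` I)"
  shows "indpt_family v (insert i I)"
proof -
  have "v i \<notin> v ` I"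
    using assms span_mem[of "v ` I"] by auto
  then have "\<not> lin_dep (v ` I \<union> {v i})"
    using assms lin_dep_iff_in_span[of "v ` I" "v i"] by (auto simp: indpt_family_def)
  then show ?thesis
    using assms \<open>v i \<notin> v ` I\<close> by (auto simp: indpt_family_def)
qed

lemma card_unit_vecs: "card (set (unit_vecs n :: 'a vec list)) = n"
  by (simp add: distinct_card[OF unit_vecs_distinct])

lemma lin_indpt_card_le_dim:
  assumes "finite S" "S \<subseteq> carrier_vec n" "lin_indpt S"
  shows "card S \<le> n"
  using lin_indpt_card_le[of S "set (unit_vecs n)"] assms
  by (simp add: card_unit_vecs span_unit_vecs_is_carrier unit_vecs_carrier)

lemma indpt_family_card_le_dim:
  assumes "finite I" "v ` I \<subseteq> carrier_vec n" "indpt_family v I"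
  shows "card I \<le> n"
  using assms lin_indpt_card_le_dim[of "v ` I"]
  by (auto simp: indpt_family_def card_image)

text \<open>Otherwise the \<open>n\<close> independent unit vectors would all lie in
  \<open>span S\<close>, and exchange would force \<open>n \<le> card S\<close>.\<close>

lemma exists_notin_span:
  assumes "finite S" "S \<subseteq> carrier_vec n" "card S < n"
  shows "\<exists>w\<in>carrier_vec n. w \<notin> span S"
proof (rule ccontr)
  assume "\<not> ?thesis"
  then have "set (unit_vecs n :: 'a vec list) \<subseteq> span S"
    using unit_vecs_carrier by blast
  then have "card (set (unit_vecs n :: 'a vec list)) \<le> card S"
    using assms unit_vecs_basis by (intro lin_indpt_card_le) (auto simp: basis_def)
  then show False
    using assms by (simp add: card_unit_vecs)
qed

text \<open>If some member lies outside the span of those at \<open>X\<close>, its index can be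
  added and the family stays as it is. Otherwise the members at \<open>X\<close> span the whole
  family, and a member at an index outside \<open>X\<close> can be overwritten by a vector outside
  that span. Iterating this step leads to full rank.\<close>

lemma enlarge_indpt_family:
  assumes "finite I" "v ` I \<subseteq> carrier_vec n"
    and X: "X \<subseteq> I" "indpt_family v X" "card X < n" "X \<noteq> I"
  shows "\<exists>w X'. w ` I \<subseteq> carrier_vec n \<and>
    (\<forall>Z\<subseteq>I. indpt_family v Z \<longrightarrow> indpt_family w Z) \<and>
    X' \<subseteq> I \<and> indpt_family w X' \<and> card X' = Suc (card X)"
proof -
  have finX: "finite X"
    using assms finite_subset by blast
  show ?thesis
  proof (cases "\<exists>i\<in>I. v i \<notin> span (v ` X)")
    case True
    then obtain i where i: "i \<in> I" "v i \<notin> span (v ` X)" by blast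
    have "i \<notin> X"
      using i span_mem[of "v ` X"] assms by blast
    moreover have "indpt_family v (insert i X)"
      using assms i by (intro indpt_family_insert) auto
    ultimately show ?thesis
      using assms i finX by (intro exI[of _ v] exI[of _ "insert i X"]) auto
  next
    case False
    then have sub: "v ` I \<subseteq> span (v ` X)" by blast
    obtain j where j: "j \<in> I" "j \<notin> X"
      using X by blast
    have "card (v ` X) < n"
      using card_image_le[OF finX, of v] X by simp
    then obtain u where u: "u \<in> carrier_vec n" "u \<notin> span (v ` X)"
      using exists_notin_span[of "v ` X"] finX assms by blast
    define w where "w = v(j := u)"
    have w: "w ` I \<subseteq> carrier_vec n"
      using assms u by (auto simp: w_def)
    have away: "indpt_family w Z \<longleftrightarrow> indpt_family v Z" if "j \<notin> Z" for Z
      using that by (intro indpt_family_cong) (auto simp: w_def)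
    have insert_j: "indpt_family w (insert j Z)"
      if "Z \<subseteq> I" "j \<notin> Z" "indpt_family v Z" for Z
    proof (rule indpt_family_insert)
      show "indpt_family w Z"
        using that away by simp
      show "w ` insert j Z \<subseteq> carrier_vec n"
        using that j w by blast
      have "w ` Z = v ` Z"
        using that by (auto simp: w_def)
      moreover have "span (v ` Z) \<subseteq> span (v ` X)"
      proof (rule span_is_subset)
        show "v ` Z \<subseteq> span (v ` X)"
          using that sub by blast
        have "v ` X \<subseteq> carrier_vec n"
          using assms by blast
        then show "submodule class_ring (span (v ` X)) V"
          by (intro span_is_submodule) simp
      qed
      ultimately show "w j \<notin> span (w ` Z)"
        using u by (auto simp: w_def)
    qed
    \<comment> \<open>A set containing \<open>j\<close> first loses \<open>j\<close>, which keeps it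
      independent, and then regains it with the value \<open>u\<close>.\<close>
    have "indpt_family w Z" if "Z \<subseteq> I" "indpt_family v Z" for Z
    proof (cases "j \<in> Z")
      case True
      then show ?thesis
        using insert_j[of "Z - {j}"] that indpt_family_mono[of v Z "Z - {j}"]
        by (auto simp: insert_absorb)
    next
      case False
      then show ?thesis using that away by simp
    qed
    then show ?thesis
      using w insert_j[of X] X j finX
      by (intro exI[of _ w] exI[of _ "insert j X"]) auto
  qed
qed

text \<open>The enlargement step is repeated from the empty set. It applies as long as
  \<open>card X\<close> is below both \<open>n\<close> and \<open>card I\<close>, and preservation
  of independent sets is transitive.\<close>

lemma exists_full_rank_family_above:
  assumes "finite I" "v ` I \<subseteq> carrier_vec n"
  shows "\<exists>w X. w ` I \<subseteq> carrier_vec n \<and>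
    (\<forall>Z\<subseteq>I. indpt_family v Z \<longrightarrow> indpt_family w Z) \<and>
    X \<subseteq> I \<and> indpt_family w X \<and> card X = min n (card I)"
proof -
  have "\<exists>w X. w ` I \<subseteq> carrier_vec n \<and>
    (\<forall>Z\<subseteq>I. indpt_family v Z \<longrightarrow> indpt_family w Z) \<and>
    X \<subseteq> I \<and> indpt_family w X \<and> card X = m" if "m \<le> min n (card I)" for m
    using that
  proof (induction m)
    case 0
    show ?case
      using assms indpt_family_empty by (intro exI[of _ v] exI[of _ "{}"]) auto
  next
    case (Suc m)
    then obtain w X where wX: "w ` I \<subseteq> carrier_vec n"
      "\<forall>Z\<subseteq>I. indpt_family v Z \<longrightarrow> indpt_family w Z"
      "X \<subseteq> I" "indpt_family w X" "card X = m"
      by auto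
    then have "card X < n" "X \<noteq> I"
      using Suc.prems by auto
    from enlarge_indpt_family[OF assms(1) wX(1,3,4) this] obtain w' X'
      where "w' ` I \<subseteq> carrier_vec n"
        "\<forall>Z\<subseteq>I. indpt_family w Z \<longrightarrow> indpt_family w' Z"
        "X' \<subseteq> I" "indpt_family w' X'" "card X' = Suc (card X)"
      by blast
    then show ?case
      using wX by (intro exI[of _ w'] exI[of _ X']) auto
  qed
  then show ?thesis by blast
qed

text \<open>The rank is the size of a maximal independent set of columns, and such a set has at most
  \<open>n\<close> elements.\<close>

lemma rank_le_dim:
  assumes "A \<in> carrier_mat n nc"
  shows "rank A \<le> n"
proof -
  have "lin_indpt {}"
    using indpt_family_empty by (simp add: indpt_family_def)
  then obtain S where S: "finite S" "maximal S (\<lambda>T. T \<subseteq> set (cols A) \<and> lin_indpt T)"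
    using maximal_exists_superset[of "set (cols A)" "\<lambda>T. T \<subseteq> set (cols A) \<and> lin_indpt T" "{}"]
    by auto
  then have "S \<subseteq> carrier_vec n" "lin_indpt S"
    using assms cols_dim[of A] by (auto simp: maximal_def)
  then show ?thesis
    using S rank_card_indpt[OF assms] lin_indpt_card_le_dim by simp
qed

end

section \<open>Full-rank matrices and the rank of the column matroid\<close>

lemma full_rank_if_col_indep:
  fixes A :: "'a::field mat"
  assumes A: "A \<in> carrier_mat r s" and X: "col_indep A X" "card X = min r s"
  shows "full_rank A"
proof -
  interpret vec_space "TYPE('a)" r .
  have "X \<subseteq> {..<s}" "inj_on (col A) X" "lin_indpt (col A ` X)"
    using A X by (auto simp: col_indep_def indpt_family_def)
  moreover from this have "col A ` X \<subseteq> set (cols A)"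
    using A by (auto simp: cols_def)
  ultimately have "min r s \<le> rank A"
    using rank_ge_card_indpt[OF A, of "col A ` X"] X by (simp add: card_image)
  then show ?thesis
    using A rank_le_nc[OF A] rank_le_dim[OF A] by (auto simp: full_rank_def)
qed

text \<open>An independent set of columns is bounded in size by both dimensions, and
  \<open>X\<close> attains the bound. The value matters because the \<open>k\<close>-dependence
  counts sets of size \<open>rk - k\<close>, with the rank of the matroid in place of
  \<open>r\<close>.\<close>

lemma rk_col_matroid:
  fixes A :: "'a::field mat"
  assumes A: "A \<in> carrier_mat r s" and X: "col_indep A X" "card X = min r s"
  shows "matroid.rk (col_indep A) = min r s"
proof -
  interpret vec_space "TYPE('a)" r .
  have le: "card Z \<le> min r s" if "col_indep A Z" for Z
  proof -
    have Z: "Z \<subseteq> {..<s}" "indpt_family (col A) Z"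
      using that A by (auto simp: col_indep_def)
    then have "card Z \<le> s"
      using card_mono[of "{..<s}" Z] by simp
    moreover have "finite Z" "col A ` Z \<subseteq> carrier_vec r"
      using Z A finite_subset by auto
    ultimately show ?thesis
      using Z indpt_family_card_le_dim by simp
  qed
  have "Max {card Z | Z. col_indep A Z} = min r s"
  proof (rule Max_eqI)
    show "min r s \<in> {card Z | Z. col_indep A Z}"
      using X(1) X(2)[symmetric] by blast
    show "finite {card Z | Z. col_indep A Z}"
      by (rule finite_subset[of _ "{..min r s}"]) (use le in auto)
  qed (use le in auto)
  then show ?thesis
    by (simp add: matroid.rk_def[OF matroid_col_indep])
qed

text \<open>The columns are the members of the enlarged family. The independent set of size
  \<open>min r s\<close> is part of the conclusion because for \<open>s < r\<close> it must consist
  of all columns.\<close>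

lemma exists_full_rank_mat_above:
  fixes v :: "nat \<Rightarrow> 'a::field vec"
  assumes "\<forall>i<s. v i \<in> carrier_vec r"
  shows "\<exists>A :: 'a mat. A \<in> carrier_mat r s \<and> full_rank A \<and> matroid.rk (col_indep A) = min r s \<and>
    (\<exists>X. col_indep A X \<and> card X = min r s) \<and>
    (\<forall>Z\<subseteq>{..<s}. vec_space.indpt_family r v Z \<longrightarrow> col_indep A Z)"
proof -
  interpret vec_space "TYPE('a)" r .
  obtain w X where w: "w ` {..<s} \<subseteq> carrier_vec r"
      "\<forall>Z\<subseteq>{..<s}. indpt_family v Z \<longrightarrow> indpt_family w Z"
      "X \<subseteq> {..<s}" "indpt_family w X" "card X = min r s"
    using exists_full_rank_family_above[of "{..<s}" v] assms by fastforce
  define A where "A = mat_of_cols r (map w [0..<s])"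
  have A: "A \<in> carrier_mat r s"
    by (simp add: A_def carrier_matI)
  have "col A i = w i" if "i < s" for i
    using that w by (auto simp: A_def)
  then have indep: "col_indep A Z \<longleftrightarrow> indpt_family w Z" if "Z \<subseteq> {..<s}" for Z
    using that A indpt_family_cong[of Z "col A" w] by (auto simp: col_indep_def)
  then have X: "col_indep A X" "card X = min r s"
    using w by auto
  then have "\<exists>X. col_indep A X \<and> card X = min r s"
    by blast
  then show ?thesis
    using A w indep full_rank_if_col_indep[OF A X] rk_col_matroid[OF A X]
    by (intro exI[of _ A]) auto
qed

section \<open>Finiteness over a finite field and attainment of the minimum\<close>

lemma finite_carrier_vec: "finite (carrier_vec n :: 'a::finite vec set)"
proof (rule finite_surj)
  show "finite {xs :: 'a list. set xs \<subseteq> UNIV \<and> length xs = n}"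
    by (rule finite_lists_length_eq) simp
  show "carrier_vec n \<subseteq> vec_of_list ` {xs :: 'a list. set xs \<subseteq> UNIV \<and> length xs = n}"
  proof
    fix v :: "'a vec" assume "v \<in> carrier_vec n"
    then show "v \<in> vec_of_list ` {xs. set xs \<subseteq> UNIV \<and> length xs = n}"
      by (intro image_eqI[of _ _ "list_of_vec v"]) (auto simp: vec_list)
  qed
qed

lemma finite_carrier_mat: "finite (carrier_mat m n :: 'a::finite mat set)"
proof (rule finite_surj)
  show "finite {vs :: 'a vec list. set vs \<subseteq> carrier_vec m \<and> length vs = n}"
    by (rule finite_lists_length_eq) (rule finite_carrier_vec)
  show "carrier_mat m n \<subseteq>
      mat_of_cols m ` {vs :: 'a vec list. set vs \<subseteq> carrier_vec m \<and> length vs = n}"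
  proof
    fix A :: "'a mat" assume A: "A \<in> carrier_mat m n"
    then show "A \<in> mat_of_cols m ` {vs. set vs \<subseteq> carrier_vec m \<and> length vs = n}"
      using cols_dim[of A] mat_of_cols_cols[of A]
      by (intro image_eqI[of _ _ "cols A"]) auto
  qed
qed

text \<open>A \<open>LEAST\<close> over the reals is meaningful only if the minimum is attained.
  Here there are finitely many matrices, hence finitely many values of the dependence, and
  \<open>D_min\<close> is their \<open>Min\<close>.\<close>

lemma D_min_le:
  fixes A :: "'a::{field,finite} mat"
  assumes A: "A \<in> carrier_mat r s" "full_rank A"
  shows "D_min TYPE('a) r k s \<le> mat_dependence A k"
proof -
  define V where "V = (\<lambda>A :: 'a mat. mat_dependence A k) ` {A \<in> carrier_mat r s. full_rank A}"
  have fin: "finite V"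
    unfolding V_def using finite_carrier_mat by (auto intro: finite_subset)
  have in_V: "mat_dependence A k \<in> V"
    using A by (auto simp: V_def)
  have "Min V \<in> V"
    using fin in_V by (intro Min_in) auto
  then obtain B :: "'a mat" where
    B: "B \<in> carrier_mat r s" "full_rank B" "Min V = mat_dependence B k"
    by (auto simp: V_def)
  have "D_min TYPE('a) r k s = Min V"
    unfolding D_min_def
  proof (rule Least_equality)
    show "\<exists>A :: 'a mat. A \<in> carrier_mat r s \<and> full_rank A \<and> mat_dependence A k \<le> Min V"
      using B by auto
  next
    fix d assume "\<exists>A :: 'a mat. A \<in> carrier_mat r s \<and> full_rank A \<and> mat_dependence A k \<le> d"
    then obtain C :: "'a mat" where
      "C \<in> carrier_mat r s" "full_rank C" "mat_dependence C k \<le> d" by blast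
    then show "Min V \<le> d"
      using fin by (auto simp: V_def intro: order_trans[OF Min_le])
  qed
  then show ?thesis
    using fin in_V by simp
qed

section \<open>Averaging over random families\<close>

text \<open>The members are independent and identically distributed, so the marginal on
  \<open>X\<close> is, up to reindexing, the law on \<open>{..<m}\<close>.\<close>

lemma prob_indpt_subfamily:
  fixes p :: "'a::field vec pmf" and s :: nat
  assumes X: "X \<subseteq> {..<s}" "card X = m"
  shows "measure_pmf.prob (Pi_pmf {..<s} d (\<lambda>_. p)) {v. vec_space.indpt_family r v X} =
    measure_pmf.prob (Pi_pmf {..<m} d (\<lambda>_. p)) {v. vec_space.indpt_family r v {..<m}}"
proof -
  interpret vec_space "TYPE('a)" r .
  have "finite X"
    using X finite_subset[of X "{..<s}"] by simp
  then obtain h0 where h0: "bij_betw h0 {..<m} X"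
    using X ex_bij_betw_nat_finite[of X] by (auto simp: atLeast0LessThan)
  \<comment> \<open>Indices from \<open>m\<close> on must be sent outside \<open>X\<close>, where
    the default value \<open>d\<close> is taken; \<open>s\<close> is such a point since
    \<open>X \<subseteq> {..<s}\<close>.\<close>
  define h where "h i = (if i < m then h0 i else s)" for i
  have h: "bij_betw h {..<m} X"
    using h0 by (subst bij_betw_cong[of _ h h0]) (auto simp: h_def)
  have "Pi_pmf {..<m} d (\<lambda>_. p) = map_pmf (\<lambda>g. g \<circ> h) (Pi_pmf X d (\<lambda>_. p))"
    using h X by (intro Pi_pmf_bij_betw) (auto simp: h_def)
  also have "\<dots> = map_pmf (\<lambda>g. g \<circ> h)
      (map_pmf (\<lambda>f x. if x \<in> X then f x else d) (Pi_pmf {..<s} d (\<lambda>_. p)))"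
    using Pi_pmf_subset[of "{..<s}" X d "\<lambda>_. p"] X by simp
  finally have "measure_pmf.prob (Pi_pmf {..<m} d (\<lambda>_. p)) {v. indpt_family v {..<m}} =
      measure_pmf.prob (Pi_pmf {..<s} d (\<lambda>_. p))
        {v. indpt_family ((\<lambda>x. if x \<in> X then v x else d) \<circ> h) {..<m}}"
    by (simp add: map_pmf_comp vimage_def)
  \<comment> \<open>On \<open>{..<m}\<close> the map \<open>h\<close> takes values in
    \<open>X\<close> only, so the default never enters.\<close>
  also have "{v. indpt_family ((\<lambda>x. if x \<in> X then v x else d) \<circ> h) {..<m}} =
      {v. indpt_family v X}"
    unfolding indpt_family_comp[OF h] by (auto cong: indpt_family_cong)
  finally show ?thesis by simp
qed

text \<open>First moment method: by linearity of expectation the mean number of dependent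
  \<open>m\<close>-sets is the right-hand side, and some family in the support does not exceed the
  mean.\<close>

lemma exists_few_dependent_subfamilies:
  fixes p :: "'a::field vec pmf"
  assumes fin_p: "finite (set_pmf p)" and p: "set_pmf p \<subseteq> carrier_vec r"
  shows "\<exists>v :: nat \<Rightarrow> 'a vec. (\<forall>i<s. v i \<in> carrier_vec r) \<and>
    real (card {X. X \<subseteq> {..<s} \<and> card X = m \<and> \<not> vec_space.indpt_family r v X}) \<le>
    (1 - measure_pmf.prob (Pi_pmf {..<m} d (\<lambda>_. p)) {v. vec_space.indpt_family r v {..<m}})
      * real (s choose m)"
proof -
  interpret vec_space "TYPE('a)" r .
  define P where "P = Pi_pmf {..<s} d (\<lambda>_. p)"
  define \<S> where "\<S> = {X. X \<subseteq> {..<s} \<and> card X = m}"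
  define \<pi> where "\<pi> = measure_pmf.prob (Pi_pmf {..<m} d (\<lambda>_. p)) {v. indpt_family v {..<m}}"
  define N :: "(nat \<Rightarrow> 'a vec) \<Rightarrow> real"
    where "N v = (\<Sum>X\<in>\<S>. indicator {v. \<not> indpt_family v X} v)" for v
  have finS: "finite \<S>" and cardS: "card \<S> = s choose m"
    using n_subsets[of "{..<s}" m] by (auto simp: \<S>_def)
  have N: "N v = real (card {X. X \<subseteq> {..<s} \<and> card X = m \<and> \<not> indpt_family v X})" for v
  proof -
    have "N v = real (card (\<S> \<inter> {X. \<not> indpt_family v X}))"
      unfolding N_def indicator_def using finS by (simp add: sum.If_cases)
    also have "\<S> \<inter> {X. \<not> indpt_family v X} =
        {X. X \<subseteq> {..<s} \<and> card X = m \<and> \<not> indpt_family v X}"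
      by (auto simp: \<S>_def)
    finally show ?thesis .
  qed
  have setP: "set_pmf P = PiE_dflt {..<s} d (\<lambda>_. set_pmf p)"
    by (simp add: P_def set_Pi_pmf comp_def)
  have finP: "finite (set_pmf P)"
    unfolding setP by (intro finite_PiE_dflt fin_p) simp
  have carrier: "\<forall>i<s. v i \<in> carrier_vec r" if "v \<in> set_pmf P" for v
  proof (intro allI impI)
    fix i assume "i < s"
    then have "v i \<in> set_pmf p"
      using that by (simp add: setP PiE_dflt_def)
    then show "v i \<in> carrier_vec r"
      using p by (rule subsetD[rotated])
  qed
  \<comment> \<open>Finite support makes every function integrable, so sum and expectation may be
    exchanged.\<close>
  have int: "integrable (measure_pmf P) f" for f :: "_ \<Rightarrow> real"
    using finP by (rule integrable_measure_pmf_finite)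
  have "measure_pmf.expectation P N =
      (\<Sum>X\<in>\<S>. measure_pmf.prob P {v. \<not> indpt_family v X})"
    unfolding N_def by (subst Bochner_Integration.integral_sum) (auto intro: int)
  also have "\<dots> = (\<Sum>X\<in>\<S>. 1 - \<pi>)"
  proof (rule sum.cong)
    fix X assume "X \<in> \<S>"
    then have "measure_pmf.prob P {v. indpt_family v X} = \<pi>"
      unfolding P_def \<pi>_def \<S>_def by (intro prob_indpt_subfamily) auto
    then show "measure_pmf.prob P {v. \<not> indpt_family v X} = 1 - \<pi>"
      using measure_pmf.prob_compl[of "{v. indpt_family v X}" P]
      by (simp add: Collect_neg_eq Compl_eq_Diff_UNIV)
  qed simp
  finally have "measure_pmf.expectation P N = (1 - \<pi>) * real (s choose m)"
    by (simp add: cardS)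
  \<comment> \<open>If \<open>N\<close> exceeded its mean on the whole support, the mean would
    exceed itself.\<close>
  then have "\<exists>v\<in>set_pmf P. N v \<le> (1 - \<pi>) * real (s choose m)"
    using measure_pmf.expectation_greater[where X = N and a = "(1 - \<pi>) * real (s choose m)",
        OF int]
    by (force simp: AE_measure_pmf_iff)
  then show ?thesis
    using carrier by (auto simp: N \<pi>_def)
qed

section \<open>Comparison of the minimum with the average\<close>

theorem theorem3:
  fixes q r k s :: nat
  assumes "primepow q"
    and "CARD('a::{field,finite}) = q"
    and "k < r"
    and "r - k \<le> s"
  shows "D_min TYPE('a) r k s \<le> 1 - indep_prob TYPE('a) r k"
proof -
  interpret vec_space "TYPE('a)" r .
  define p where "p = pmf_of_set (carrier_vec r - {0\<^sub>v r :: 'a vec})"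
  \<comment> \<open>The uniform distribution needs a nonempty set; \<open>r > 0\<close> follows from
    \<open>k < r\<close>.\<close>
  have "(unit_vec r 0 :: 'a vec) \<in> carrier_vec r - {0\<^sub>v r :: 'a vec}"
    using assms by auto
  then have p: "set_pmf p = carrier_vec r - {0\<^sub>v r}"
    unfolding p_def by (intro set_pmf_of_set finite_Diff finite_carrier_vec) blast
  then have "finite (set_pmf p)" "set_pmf p \<subseteq> carrier_vec r"
    using finite_carrier_vec by auto
  from exists_few_dependent_subfamilies[OF this, of s "r - k" "0\<^sub>v r"] obtain v
    where v: "\<forall>i<s. v i \<in> carrier_vec r"
      and few: "real (card {X. X \<subseteq> {..<s} \<and> card X = r - k \<and> \<not> indpt_family v X}) \<le>
        (1 - indep_prob TYPE('a) r k) * real (s choose (r - k))"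
    unfolding indep_prob_def p_def by blast
  from exists_full_rank_mat_above[OF v] obtain A :: "'a mat" and B where
    A: "A \<in> carrier_mat r s" "full_rank A" and rk: "matroid.rk (col_indep A) = min r s"
    and base: "col_indep A B" "card B = min r s"
    and above: "\<forall>Z\<subseteq>{..<s}. indpt_family v Z \<longrightarrow> col_indep A Z"
    by (elim exE conjE)
  interpret M: matroid "{..<s}" "col_indep A"
    using matroid_col_indep[of A] A by simp
  have dep: "mat_dependence A k =
    real (card {X. X \<subseteq> {..<s} \<and> card X = min r s - k \<and> \<not> col_indep A X}) /
    real (s choose (min r s - k))"
    using A n_subsets[of "{..<s}" "min r s - k"]
    by (simp add: mat_dependence_def M.k_dependence_def rk)
  have "mat_dependence A k \<le> 1 - indep_prob TYPE('a) r k"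
  proof (cases "s < r")
    case True
    \<comment> \<open>The rank is now \<open>s\<close>, so the counted sets have size
      \<open>s - k\<close> and the average over sets of size \<open>r - k\<close> says nothing about
      them. Instead all columns are independent, and the dependence is \<open>0\<close>.\<close>
    then have "B = {..<s}"
      using base M.indep_subset_ground[of B] card_subset_eq[of "{..<s}" B] by simp
    then have "col_indep A {..<s}"
      using base by simp
    then have "{X. X \<subseteq> {..<s} \<and> card X = min r s - k \<and> \<not> col_indep A X} = {}"
      using M.indep_mono by blast
    then have "mat_dependence A k = 0"
      unfolding dep by simp
    then show ?thesis
      by (simp add: indep_prob_def)
  next
    case False
    \<comment> \<open>Here \<open>min r s = r\<close>. Passing from \<open>v\<close> to
      \<open>A\<close> preserves independent sets, so it creates no new dependent ones.\<close>
    have "card {X. X \<subseteq> {..<s} \<and> card X = r - k \<and> \<not> col_indep A X} \<le>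
        card {X. X \<subseteq> {..<s} \<and> card X = r - k \<and> \<not> indpt_family v X}"
      using above by (intro card_mono) auto
    then have "real (card {X. X \<subseteq> {..<s} \<and> card X = r - k \<and> \<not> col_indep A X}) \<le>
        (1 - indep_prob TYPE('a) r k) * real (s choose (r - k))"
      using few by linarith
    moreover have "0 < real (s choose (r - k))"
      using assms by simp
    ultimately show ?thesis
      unfolding dep using False by (simp add: pos_divide_le_eq)
  qed
  then show ?thesis
    using D_min_le[OF A, of k] by linarith
qed

end
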